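(* For $\beta>0$, $0<\beta_1<\beta_2$, $\nu>0$, $\mu\in\mathbb{C}$ and $k=0,1,\dots$, the following relations hold (as functions of $t>0$): (a) $$\big(I-\mu J^\beta\big)^k\Big[\frac{t^{k\beta+\nu-1}}{k!}E^{(k)}_{\beta,\nu}(\mu t^\beta)\Big]=J^{k\beta}\big[t^{\nu-1}E_{\beta,\nu}(\mu t^\beta)\big];$$ (b) $$\big(J^{\beta_2-\beta_1}-\mu J^{\beta_2}\big)^k\Big[\frac{t^{k\beta_1+\nu-1}}{k!}E^{(k)}_{\beta_1,\nu}(\mu t^{\beta_1})\Big]=J^{k\beta_2}\big[t^{\nu-1}E_{\beta_1,\nu}(\mu t^{\beta_1})\big],$$ where $I$ is the identity operator and $J^\beta$ is the fractional integral of order $\beta$.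
   Context: $J^\gamma f(t)=\frac1{\Gamma(\gamma)}\int_0^t(t-\tau)^{\gamma-1}f(\tau)\,d\tau$ for $\gamma>0$, $J^0=I$. $E_{\beta,\nu}(z)=\sum_{n=0}^\infty\frac{z^n}{\Gamma(\beta n+\nu)}$ is the two-parameter Mittag-Leffler function, and $E^{(k)}_{\beta,\nu}(z)=\frac{d^k}{dz^k}E_{\beta,\nu}(z)$. *)

theory Defs
  imports "HOL-Analysis.Analysis"
begin

text \<open>
  Fractional integral of order \<open>\<gamma> \<ge> 0\<close> of a function on \<open>t > 0\<close>; the integral is a Lebesgue
  integral, and the value at \<open>t > 0\<close> depends only on the values of \<open>f\<close> on \<open>]0, t]\<close>.
\<close>

definition frac_integral :: "real \<Rightarrow> (real \<Rightarrow> complex) \<Rightarrow> real \<Rightarrow> complex" where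
  "frac_integral \<gamma> f t =
     (if \<gamma> = 0 then f t
      else (1 / complex_of_real (Gamma \<gamma>)) *
           (LINT \<tau>:{0..t}|lborel. complex_of_real ((t - \<tau>) powr (\<gamma> - 1)) * f \<tau>))"

text \<open>
  Since \<open>Gamma\<close> is \<open>0\<close> at its poles and \<open>x / 0 = 0\<close>, the terms with \<open>\<beta> n + \<nu>\<close> at a pole
  vanish, which is the usual convention for \<open>1 / \<Gamma>\<close>.
\<close>

definition mittag_leffler :: "real \<Rightarrow> real \<Rightarrow> complex \<Rightarrow> complex" where
  "mittag_leffler \<beta> \<nu> z = (\<Sum>n. z ^ n / complex_of_real (Gamma (\<beta> * real n + \<nu>)))"

end

theory Submission
  imports Defs
begin

text \<open>
  Write \<open>g\<^sub>x(t) = t\<^bsup>x - 1\<^esup> / \<Gamma>(x)\<close>. Euler's Beta integral is the semigroup law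
  \<open>J\<^sup>\<gamma> g\<^sub>x = g\<^bsub>x + \<gamma>\<^esub>\<close>, so on a series \<open>\<Sum>\<^sub>n a\<^sub>n g\<^bsub>\<beta> n + \<rho>\<^esub>\<close> the operator \<open>J\<^sup>\<gamma>\<close> only moves
  the offset from \<open>\<rho>\<close> to \<open>\<rho> + \<gamma>\<close> (\<open>frac_integral_kernel_series\<close>). In particular \<open>J\<^sup>\<beta>\<close> amounts
  to shifting the coefficient sequence by one place, that is, to multiplying its generating
  function \<open>\<Sum>\<^sub>n a\<^sub>n x\<^sup>n\<close> by \<open>x\<close>.

  The \<open>k\<close>-th derivative in the theorem is such a series with offset \<open>k \<beta> + \<nu>\<close> and coefficients
  \<open>binom(n + k, k) \<mu>\<^sup>n\<close>, whose generating function is \<open>(1 - \<mu> x)\<close> to the power \<open>- (k + 1)\<close>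
  (\<open>deriv_mittag_leffler_conv_kernel_series\<close>). For \<open>\<delta> \<ge> 0\<close> the operator
  \<open>J\<^sup>\<delta> - \<mu> J\<^bsup>\<beta> + \<delta>\<^esup>\<close> adds \<open>\<delta>\<close> to the offset and multiplies the generating function by \<open>1 - \<mu> x\<close>
  (\<open>frac_integral_diff_kernel_series\<close>; on coefficients this is Pascal's rule). After \<open>k\<close> steps
  the coefficients are \<open>\<mu>\<^sup>n\<close> and the offset is \<open>\<nu> + k (\<beta> + \<delta>)\<close>, which is
  \<open>J\<^bsup>k (\<beta> + \<delta>)\<^esup>\<close> applied to the case \<open>k = 0\<close> of the same series. The two relations are the
  cases \<open>\<delta> = 0\<close> and \<open>\<beta> = \<beta>\<^sub>1\<close>, \<open>\<delta> = \<beta>\<^sub>2 - \<beta>\<^sub>1\<close>.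

  All intermediate identities are stated on \<open>t \<ge> 0\<close> instead of \<open>t > 0\<close>: since
  \<open>0 powr x = 0\<close>, every function to which an integral is applied vanishes at \<open>0\<close>, and then equal
  functions can be substituted under the integral over \<open>[0, t]\<close> without any appeal to null sets.
\<close>

section \<open>Power kernels\<close>

definition power_kernel :: "real \<Rightarrow> real \<Rightarrow> real" where
  "power_kernel x t = t powr (x - 1) / Gamma x"

lemma power_kernel_nonneg: "x > 0 \<Longrightarrow> power_kernel x t \<ge> 0"
  by (simp add: power_kernel_def Gamma_real_pos less_imp_le)

lemma power_kernel_0 [simp]: "power_kernel x 0 = 0"
  by (simp add: power_kernel_def)

text \<open>
  The law \<open>J\<^sup>x g\<^sub>y = g\<^bsub>y + x\<^esub>\<close>: the substitution \<open>s = t u\<close> turns the convolution into the Beta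
  integral over \<open>u \<in> [0, 1]\<close>. Integrability is part of the conclusion because the exchange of sum
  and integral below needs it.
\<close>

lemma power_kernel_convolution:
  assumes x: "x > 0" and y: "y > 0" and t: "t \<ge> 0"
  shows "has_bochner_integral lborel
           (\<lambda>s. indicator {0..t} s * (power_kernel x (t - s) * power_kernel y s))
           (power_kernel (y + x) t)"
proof (cases "t = 0")
  case True
  have "(\<lambda>s. indicator {0..t} s * (power_kernel x (t - s) * power_kernel y s)) = (\<lambda>s. 0)"
    using True by (auto simp: indicator_def)
  then show ?thesis
    using True by (simp add: has_bochner_integral_zero)
next
  case False
  with t have t: "t > 0" by simp
  define b where "b = (\<lambda>u::real. u powr (y - 1) * (1 - u) powr (x - 1))"
  have int: "set_integrable lborel {0..1} b"
    unfolding b_def by (rule integrable_Beta[OF y x])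
  have "set_lebesgue_integral lborel {0..1} b = Beta y x"
    using set_borel_integral_eq_integral(2)[OF int] has_integral_Beta_real[OF y x]
    by (simp add: b_def integral_unique)
  with int have "has_bochner_integral lborel (\<lambda>u. indicator {0..1} u * b u) (Beta y x)"
    by (simp add: has_bochner_integral_iff set_integrable_def set_lebesgue_integral_def)
  then have "has_bochner_integral lborel
      (\<lambda>s. indicator {0..1} (0 + 1 / t * s) * b (0 + 1 / t * s)) (Beta y x /\<^sub>R \<bar>1 / t\<bar>)"
    using t by (subst (asm) lborel_has_bochner_integral_real_affine_iff[of "1 / t" _ _ 0]) simp_all
  then have *: "has_bochner_integral lborel
      (\<lambda>s. t powr (x + y - 2) / (Gamma x * Gamma y) * (indicator {0..1} (s / t) * b (s / t)))
      (t powr (x + y - 2) / (Gamma x * Gamma y) * (Beta y x * t))"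
    using t by (intro has_bochner_integral_mult_right) (simp add: mult.commute)
  have fun_eq: "t powr (x + y - 2) / (Gamma x * Gamma y) * (indicator {0..1} (s / t) * b (s / t))
      = indicator {0..t} s * (power_kernel x (t - s) * power_kernel y s)" for s
  proof (cases "s \<in> {0..t}")
    case True
    have "1 - s / t = (t - s) / t"
      using t by (simp add: field_simps)
    then have "b (s / t) = s powr (y - 1) / t powr (y - 1) * ((t - s) powr (x - 1) / t powr (x - 1))"
      using True t by (simp add: b_def powr_divide)
    moreover have "t powr (x + y - 2) = t powr (y - 1) * t powr (x - 1)"
      by (simp flip: powr_add add: algebra_simps)
    ultimately show ?thesis
      using True t by (simp add: power_kernel_def)
  next
    case False
    then show ?thesis
      using t by (auto simp: indicator_def field_simps)
  qed
  have "t powr (y + x - 1) = t powr (x + y - 2) * t"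
    using powr_add[of t "x + y - 2" 1] t by (simp add: algebra_simps)
  moreover have "Gamma x \<noteq> 0" "Gamma y \<noteq> 0"
    using Gamma_real_pos[OF x] Gamma_real_pos[OF y] by simp_all
  ultimately have int_eq:
    "t powr (x + y - 2) / (Gamma x * Gamma y) * (Beta y x * t) = power_kernel (y + x) t"
    by (simp add: power_kernel_def Beta_def)
  show ?thesis
    using * unfolding fun_eq int_eq .
qed

section \<open>Series of power kernels\<close>

text \<open>
  Bound Euler's integral from below by its part over \<open>[R, R + 1]\<close>. Since \<open>R\<close> is arbitrary, this
  makes \<open>\<Gamma>\<close> grow faster than every exponential, with explicit constants.
\<close>

lemma Gamma_ge_powr:
  fixes y R :: real
  assumes y: "y \<ge> 1" and R: "R > 0"
  shows "R powr (y - 1) * exp (- (R + 1)) \<le> Gamma y"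
proof -
  let ?c = "R powr (y - 1) * exp (- (R + 1))"
  have "((\<lambda>t. ?c) has_integral ?c) {R..R + 1}"
    using has_integral_const_real[of ?c R "R + 1"] by simp
  then have "((\<lambda>t. if t \<in> {R..R + 1} then ?c else 0) has_integral ?c) {0..}"
    using R by (subst has_integral_restrict) auto
  moreover have "((\<lambda>t. t powr (y - 1) / exp t) has_integral Gamma y) {0..}"
    using y by (intro Gamma_integral_real) simp
  ultimately show ?thesis
  proof (rule has_integral_le)
    fix t :: real
    assume "t \<in> {0..}"
    show "(if t \<in> {R..R + 1} then ?c else 0) \<le> t powr (y - 1) / exp t"
    proof (cases "t \<in> {R..R + 1}")
      case True
      then have "?c \<le> t powr (y - 1) * exp (- t)"
        using y R by (intro mult_mono powr_mono2) auto
      also have "\<dots> = t powr (y - 1) / exp t"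
        by (simp add: exp_minus divide_inverse)
      finally show ?thesis
        using True by (simp only: if_True)
    next
      case False
      then show ?thesis
        by (subst if_not_P) simp_all
    qed
  qed
qed

text \<open>
  Hence a series of power kernels converges on the whole half line as soon as the power series
  with the same coefficients converges absolutely at one point \<open>r > 0\<close>.
\<close>

lemma summable_power_kernel:
  fixes a :: "nat \<Rightarrow> real"
  assumes \<beta>: "\<beta> > 0" and \<rho>: "\<rho> > 0" and t: "t \<ge> 0" and r: "r > 0"
    and a: "summable (\<lambda>n. \<bar>a n\<bar> * r ^ n)"
  shows "summable (\<lambda>n. \<bar>a n\<bar> * power_kernel (\<beta> * real n + \<rho>) t)"
proof (cases "t = 0")
  case False
  with t have t: "t > 0" by simp
  \<comment> \<open>With this \<open>R\<close> the bound on \<open>1 / \<Gamma>(\<beta> n + \<rho>)\<close> times \<open>t\<^bsup>\<beta> n\<^esup>\<close> is a constant times \<open>r\<^sup>n\<close>.\<close>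
  define R where "R = t * r powr (- (1 / \<beta>))"
  have R: "R > 0"
    using t r by (simp add: R_def)
  define C where "C = exp (R + 1) * (t / R) powr (\<rho> - 1)"
  have "t / R = r powr (1 / \<beta>)"
    using t r by (simp add: R_def powr_minus field_simps)
  then have "(t / R) powr (\<beta> * real n) = r ^ n" for n
    using \<beta> r by (simp add: powr_powr powr_realpow)
  then have geo: "(t / R) powr (\<beta> * real n + \<rho> - 1) = r ^ n * (t / R) powr (\<rho> - 1)" for n
    using powr_add[of "t / R" "\<beta> * real n" "\<rho> - 1"] by (simp add: add_diff_eq)
  obtain N :: nat where "1 / \<beta> \<le> real N"
    using real_arch_simple by blast
  then have N: "1 \<le> \<beta> * real n + \<rho>" if "n \<ge> N" for n
  proof -
    have "1 / \<beta> \<le> real n"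
      using \<open>1 / \<beta> \<le> real N\<close> that by linarith
    then show ?thesis
      using \<beta> \<rho> by (simp add: field_simps)
  qed
  show ?thesis
  proof (rule summable_comparison_test')
    show "summable (\<lambda>n. C * (\<bar>a n\<bar> * r ^ n))"
      by (rule summable_mult[OF a])
  next
    fix n
    assume "n \<ge> N"
    let ?y = "\<beta> * real n + \<rho>"
    have pos: "R powr (?y - 1) * exp (- (R + 1)) > 0"
      using R by simp
    have le: "R powr (?y - 1) * exp (- (R + 1)) \<le> Gamma ?y"
      using N[OF \<open>n \<ge> N\<close>] R by (rule Gamma_ge_powr)
    have "power_kernel ?y t \<le> t powr (?y - 1) / (R powr (?y - 1) * exp (- (R + 1)))"
      unfolding power_kernel_def using le pos by (intro divide_left_mono mult_pos_pos) auto
    also have "\<dots> = exp (R + 1) * (t / R) powr (?y - 1)"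
      unfolding exp_minus using t R by (simp add: powr_divide field_simps)
    also have "\<dots> = C * r ^ n"
      by (simp add: geo C_def)
    finally have "\<bar>a n\<bar> * power_kernel ?y t \<le> \<bar>a n\<bar> * (C * r ^ n)"
      by (intro mult_left_mono) auto
    moreover have "power_kernel ?y t \<ge> 0"
      using N[OF \<open>n \<ge> N\<close>] by (intro power_kernel_nonneg) simp
    ultimately show "norm (\<bar>a n\<bar> * power_kernel ?y t) \<le> C * (\<bar>a n\<bar> * r ^ n)"
      by (simp add: mult_ac)
  qed
qed simp

definition kernel_series :: "real \<Rightarrow> real \<Rightarrow> (nat \<Rightarrow> complex) \<Rightarrow> real \<Rightarrow> complex" where
  "kernel_series \<beta> \<rho> a t = (\<Sum>n. a n * complex_of_real (power_kernel (\<beta> * real n + \<rho>) t))"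

lemma summable_norm_kernel_series:
  fixes a :: "nat \<Rightarrow> complex"
  assumes "\<beta> > 0" "\<rho> > 0" "t \<ge> 0" "r > 0" "summable (\<lambda>n. norm (a n) * r ^ n)"
  shows "summable (\<lambda>n. norm (a n * complex_of_real (power_kernel (\<beta> * real n + \<rho>) t)))"
proof -
  have "\<beta> * real n + \<rho> > 0" for n
    using assms by (intro add_nonneg_pos) auto
  then show ?thesis
    using summable_power_kernel[of \<beta> \<rho> t r "\<lambda>n. norm (a n)"] assms
    by (simp add: norm_mult power_kernel_nonneg)
qed

lemmas summable_kernel_series = summable_norm_kernel_series[THEN summable_norm_cancel]

text \<open>
  The sum and the integral may be exchanged because the integrals of the absolute values are
  \<open>\<bar>a\<^sub>n\<bar> g\<^bsub>\<beta> n + \<rho> + \<gamma>\<^esub>(t)\<close>, and these are summable for the same reason as the series itself.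
\<close>

lemma frac_integral_kernel_series:
  fixes a :: "nat \<Rightarrow> complex"
  assumes \<beta>: "\<beta> > 0" and \<rho>: "\<rho> > 0" and \<gamma>: "\<gamma> \<ge> 0" and t: "t \<ge> 0"
    and r: "r > 0" and a: "summable (\<lambda>n. norm (a n) * r ^ n)"
    and f: "\<And>s. s \<ge> 0 \<Longrightarrow> f s = kernel_series \<beta> \<rho> a s"
  shows "frac_integral \<gamma> f t = kernel_series \<beta> (\<rho> + \<gamma>) a t"
proof (cases "\<gamma> = 0")
  case True
  with f t show ?thesis
    by (simp add: frac_integral_def)
next
  case False
  with \<gamma> have \<gamma>: "\<gamma> > 0" by simp
  let ?y = "\<lambda>n. \<beta> * real n + \<rho>"
  have y: "?y n > 0" for n
    using \<beta> \<rho> by (intro add_nonneg_pos) auto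
  define w where "w = (\<lambda>n s. indicator {0..t} s * (power_kernel \<gamma> (t - s) * power_kernel (?y n) s))"
  have w_nonneg: "w n s \<ge> 0" for n s
    using \<gamma> y by (simp add: w_def power_kernel_nonneg)
  have w_int: "has_bochner_integral lborel (w n) (power_kernel (?y n + \<gamma>) t)" for n
    unfolding w_def by (rule power_kernel_convolution[OF \<gamma> y t])
  define F where "F = (\<lambda>n s. a n * complex_of_real (w n s))"
  have F_int: "has_bochner_integral lborel (F n) (a n * complex_of_real (power_kernel (?y n + \<gamma>) t))" for n
    unfolding F_def using w_int
    by (intro has_bochner_integral_mult_right has_bochner_integral_of_real)
  have norm_int: "has_bochner_integral lborel (\<lambda>s. norm (F n s)) (norm (a n) * power_kernel (?y n + \<gamma>) t)" for n
    using has_bochner_integral_mult_right[OF w_int, of "norm (a n)" n] w_nonneg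
    by (simp add: F_def norm_mult)
  have F_eq: "F n s = indicator {0..t} s * (power_kernel \<gamma> (t - s) * (a n * power_kernel (?y n) s))" for n s
    by (simp add: F_def w_def indicator_def)
  have summ: "summable (\<lambda>n. a n * complex_of_real (power_kernel (?y n) s))"
    "summable (\<lambda>n. norm (a n * complex_of_real (power_kernel (?y n) s)))" if "s \<ge> 0" for s
    using summable_norm_kernel_series[OF \<beta> \<rho> that r a] by (simp_all add: summable_norm_cancel)
  have F_sum: "summable (\<lambda>n. norm (F n s))" for s
  proof (cases "s \<in> {0..t}")
    case True
    then have "norm (F n s) = power_kernel \<gamma> (t - s) * norm (a n * complex_of_real (power_kernel (?y n) s))" for n
      using \<gamma> by (simp add: F_eq norm_mult power_kernel_nonneg)
    with True show ?thesis
      using summ(2)[of s] by (simp add: summable_mult)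
  qed (simp add: F_eq)
  have int_sum: "summable (\<lambda>n. \<integral>s. norm (F n s) \<partial>lborel)"
    using summable_norm_kernel_series[OF \<beta> _ t r a, of "\<rho> + \<gamma>"] \<rho> \<gamma> y
      has_bochner_integral_integral_eq[OF norm_int]
    by (simp add: norm_mult power_kernel_nonneg add_pos_pos flip: add.assoc)
  have "frac_integral \<gamma> f t = (\<integral>s. (\<Sum>n. F n s) \<partial>lborel)"
  proof -
    have "(\<Sum>n. F n s) = 1 / complex_of_real (Gamma \<gamma>) *
        (indicator {0..t} s *\<^sub>R (complex_of_real ((t - s) powr (\<gamma> - 1)) * f s))" for s
    proof (cases "s \<in> {0..t}")
      case True
      then have "(\<Sum>n. F n s) = complex_of_real (power_kernel \<gamma> (t - s)) * f s"
        using suminf_mult[OF summ(1)[of s], of "complex_of_real (power_kernel \<gamma> (t - s))"] f[of s]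
        by (simp add: F_eq kernel_series_def)
      with True show ?thesis
        by (simp add: power_kernel_def)
    qed (simp add: F_eq)
    then show ?thesis
      using \<gamma> unfolding frac_integral_def set_lebesgue_integral_def
      by (simp only: integral_mult_right_zero if_False less_imp_neq[symmetric])
  qed
  also have "\<dots> = (\<Sum>n. integral\<^sup>L lborel (F n))"
    using F_sum int_sum has_bochner_integral_iff[THEN iffD1, OF F_int]
    by (intro integral_suminf) auto
  also have "\<dots> = kernel_series \<beta> (\<rho> + \<gamma>) a t"
    unfolding kernel_series_def has_bochner_integral_integral_eq[OF F_int] by (simp add: add.assoc)
  finally show ?thesis .
qed

section \<open>The operator on coefficient sequences\<close>

text \<open>
  The Taylor coefficients of \<open>1 / (1 - \<mu> x)\<^bsup>k + 1\<^esup>\<close>.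
\<close>

definition neg_binomial_coeff :: "complex \<Rightarrow> nat \<Rightarrow> nat \<Rightarrow> complex" where
  "neg_binomial_coeff \<mu> k n = of_nat ((n + k) choose k) * \<mu> ^ n"

lemma neg_binomial_coeff_summable:
  obtains r :: real where "r > 0" "summable (\<lambda>n. norm (neg_binomial_coeff \<mu> k n) * r ^ n)"
proof
  \<comment> \<open>The binomial coefficient is at most \<open>2\<^bsup>n + k\<^esup>\<close>, and \<open>\<bar>\<mu>\<bar> r \<le> 1 / 4\<close> leaves the ratio \<open>1 / 2\<close>.\<close>
  let ?r = "1 / (4 * (norm \<mu> + 1))"
  show r: "?r > 0"
    by (simp add: add_nonneg_pos)
  show "summable (\<lambda>n. norm (neg_binomial_coeff \<mu> k n) * ?r ^ n)"
  proof (rule summable_comparison_test')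
    show "summable (\<lambda>n. 2 ^ k * (1 / 2 :: real) ^ n)"
      by (intro summable_mult summable_geometric) simp
  next
    fix n :: nat
    have "real ((n + k) choose k) \<le> real (2 ^ (n + k))"
      by (subst of_nat_le_iff) (rule binomial_le_pow2)
    moreover have "norm \<mu> * ?r \<le> 1 / 4"
      using norm_ge_zero[of \<mu>] by (simp add: divide_le_eq not_less)
    then have "norm \<mu> ^ n * ?r ^ n \<le> (1 / 4) ^ n"
      unfolding power_mult_distrib[symmetric] by (intro power_mono) auto
    ultimately have "real ((n + k) choose k) * (norm \<mu> ^ n * ?r ^ n) \<le> 2 ^ (n + k) * (1 / 4) ^ n"
      by (intro mult_mono) auto
    also have "\<dots> = 2 ^ k * (2 * (1 / 4)) ^ n"
      unfolding power_add power_mult_distrib by (simp only: mult_ac)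
    finally have "real ((n + k) choose k) * (norm \<mu> ^ n * ?r ^ n) \<le> 2 ^ k * (1 / 2) ^ n"
      by simp
    then show "norm (norm (neg_binomial_coeff \<mu> k n) * ?r ^ n) \<le> 2 ^ k * (1 / 2) ^ n"
      by (simp add: neg_binomial_coeff_def norm_mult norm_power mult.assoc)
  qed
qed

text \<open>
  Multiplying \<open>1 / (1 - \<mu> x)\<^bsup>k + 2\<^esup>\<close> by \<open>1 - \<mu> x\<close>, coefficient by coefficient.
\<close>

lemma neg_binomial_coeff_pascal:
  "neg_binomial_coeff \<mu> (Suc k) (Suc n) - \<mu> * neg_binomial_coeff \<mu> (Suc k) n
     = neg_binomial_coeff \<mu> k (Suc n)"
  by (simp add: neg_binomial_coeff_def algebra_simps)

text \<open>
  Raising the offset by \<open>\<beta>\<close> moves the coefficient \<open>a\<^sub>n\<close> to the kernel with index \<open>n + 1\<close>, so the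
  difference of the two integrals has coefficients \<open>a\<^sub>n - \<mu> a\<^bsub>n - 1\<^esub>\<close>.
\<close>

lemma frac_integral_diff_kernel_series:
  assumes \<beta>: "\<beta> > 0" and \<rho>: "\<rho> > 0" and \<delta>: "\<delta> \<ge> 0" and t: "t \<ge> 0"
    and f: "\<And>s. s \<ge> 0 \<Longrightarrow> f s = kernel_series \<beta> \<rho> (neg_binomial_coeff \<mu> (Suc k)) s"
  shows "frac_integral \<delta> f t - \<mu> * frac_integral (\<beta> + \<delta>) f t
           = kernel_series \<beta> (\<rho> + \<delta>) (neg_binomial_coeff \<mu> k) t"
proof -
  let ?a = "neg_binomial_coeff \<mu> (Suc k)" and ?c = "neg_binomial_coeff \<mu> k"
  let ?p = "\<lambda>n. complex_of_real (power_kernel (\<beta> * real n + (\<rho> + \<delta>)) t)"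
  obtain r where r: "r > 0" "summable (\<lambda>n. norm (?a n) * r ^ n)"
    by (rule neg_binomial_coeff_summable)
  obtain q where q: "q > 0" "summable (\<lambda>n. norm (?c n) * q ^ n)"
    by (rule neg_binomial_coeff_summable)
  have Suc_p: "complex_of_real (power_kernel (\<beta> * real n + (\<rho> + (\<beta> + \<delta>))) t) = ?p (Suc n)" for n
    by (simp add: algebra_simps)
  have pascal: "?a (Suc n) * ?p (Suc n) - \<mu> * (?a n * ?p (Suc n)) = ?c (Suc n) * ?p (Suc n)" for n
    unfolding neg_binomial_coeff_pascal[of \<mu> k n, symmetric] by (simp only: left_diff_distrib mult.assoc)
  have a_sum: "summable (\<lambda>n. ?a n * ?p n)"
    using summable_kernel_series[OF \<beta> _ t r, of "\<rho> + \<delta>"] \<rho> \<delta>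
    by simp
  then have a_sum': "summable (\<lambda>n. ?a (Suc n) * ?p (Suc n))"
    by (subst summable_Suc_iff)
  have c_sum: "summable (\<lambda>n. ?c n * ?p n)"
    using summable_kernel_series[OF \<beta> _ t q, of "\<rho> + \<delta>"] \<rho> \<delta>
    by simp
  have shift_sum: "summable (\<lambda>n. ?a n * ?p (Suc n))"
    using summable_kernel_series[OF \<beta> _ t r, of "\<rho> + (\<beta> + \<delta>)"] \<rho> \<delta> \<beta>
    unfolding Suc_p by simp
  have "frac_integral \<delta> f t = (\<Sum>n. ?a n * ?p n)"
    using frac_integral_kernel_series[OF \<beta> \<rho> \<delta> t r f] by (simp add: kernel_series_def)
  moreover have "frac_integral (\<beta> + \<delta>) f t = (\<Sum>n. ?a n * ?p (Suc n))"
    using frac_integral_kernel_series[OF \<beta> \<rho> _ t r f, of "\<beta> + \<delta>"] \<beta> \<delta>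
    unfolding kernel_series_def Suc_p by simp
  ultimately have "frac_integral \<delta> f t - \<mu> * frac_integral (\<beta> + \<delta>) f t
      = ?a 0 * ?p 0 + ((\<Sum>n. ?a (Suc n) * ?p (Suc n)) - (\<Sum>n. \<mu> * (?a n * ?p (Suc n))))"
    using suminf_split_head[OF a_sum] suminf_mult[OF shift_sum, of \<mu>] by simp
  also have "(\<Sum>n. ?a (Suc n) * ?p (Suc n)) - (\<Sum>n. \<mu> * (?a n * ?p (Suc n)))
      = (\<Sum>n. ?a (Suc n) * ?p (Suc n) - \<mu> * (?a n * ?p (Suc n)))"
    by (rule suminf_diff[OF a_sum' summable_mult[OF shift_sum]])
  also have "\<dots> = (\<Sum>n. ?c (Suc n) * ?p (Suc n))"
    unfolding pascal ..
  also have "?a 0 * ?p 0 + (\<Sum>n. ?c (Suc n) * ?p (Suc n))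
      = ?c 0 * ?p 0 + (\<Sum>n. ?c (Suc n) * ?p (Suc n))"
    by (simp add: neg_binomial_coeff_def)
  also have "?c 0 * ?p 0 + (\<Sum>n. ?c (Suc n) * ?p (Suc n)) = kernel_series \<beta> (\<rho> + \<delta>) ?c t"
    using suminf_split_head[OF c_sum] by (simp add: kernel_series_def)
  finally show ?thesis .
qed

lemma funpow_frac_integral_diff:
  assumes \<beta>: "\<beta> > 0" and \<delta>: "\<delta> \<ge> 0"
    and "\<rho> > 0" and "t \<ge> 0"
    and "\<And>s. s \<ge> 0 \<Longrightarrow> f s = kernel_series \<beta> \<rho> (neg_binomial_coeff \<mu> k) s"
  shows "((\<lambda>f s. frac_integral \<delta> f s - \<mu> * frac_integral (\<beta> + \<delta>) f s) ^^ k) f t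
           = kernel_series \<beta> (\<rho> + real k * \<delta>) (neg_binomial_coeff \<mu> 0) t"
  using assms(3-)
proof (induction k arbitrary: f \<rho>)
  case 0
  then show ?case by simp
next
  case (Suc k)
  let ?g = "\<lambda>s. frac_integral \<delta> f s - \<mu> * frac_integral (\<beta> + \<delta>) f s"
  have "?g s = kernel_series \<beta> (\<rho> + \<delta>) (neg_binomial_coeff \<mu> k) s" if "s \<ge> 0" for s
    using Suc.prems that by (intro frac_integral_diff_kernel_series[OF \<beta> _ \<delta>]) auto
  then have "((\<lambda>f s. frac_integral \<delta> f s - \<mu> * frac_integral (\<beta> + \<delta>) f s) ^^ k) ?g t
      = kernel_series \<beta> ((\<rho> + \<delta>) + real k * \<delta>) (neg_binomial_coeff \<mu> 0) t"
    using Suc.prems \<delta> by (intro Suc.IH) auto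
  then show ?case
    by (simp only: funpow_Suc_right o_def) (simp add: algebra_simps)
qed

section \<open>Derivatives of the Mittag-Leffler function\<close>

lemma fps_nth_deriv_nth:
  "fps_nth (fps_nth_deriv k f) n = fact (n + k) / fact n * fps_nth (f :: 'a :: field_char_0 fps) (n + k)"
proof (induction k arbitrary: f)
  case (Suc k)
  then show ?case by (simp add: algebra_simps)
qed simp

lemma funpow_deriv_eval_fps:
  fixes f :: "complex fps"
  assumes "fps_conv_radius f = \<infinity>"
  shows "(deriv ^^ k) (eval_fps f) = eval_fps (fps_nth_deriv k f)"
  using assms
proof (induction k arbitrary: f)
  case (Suc k)
  have "deriv (eval_fps f) = eval_fps (fps_deriv f)"
    using Suc.prems by (intro ext DERIV_imp_deriv has_field_derivative_eval_fps) simp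
  moreover have "fps_conv_radius (fps_deriv f) = \<infinity>"
    using fps_conv_radius_deriv[of f] Suc.prems by simp
  ultimately show ?case
    using Suc.IH[of "fps_deriv f"] by (simp only: funpow_Suc_right o_def fps_nth_deriv.simps)
qed simp

definition mittag_leffler_fps :: "real \<Rightarrow> real \<Rightarrow> complex fps" where
  "mittag_leffler_fps \<beta> \<nu> = Abs_fps (\<lambda>n. 1 / complex_of_real (Gamma (\<beta> * real n + \<nu>)))"

lemma mittag_leffler_conv_eval_fps: "mittag_leffler \<beta> \<nu> = eval_fps (mittag_leffler_fps \<beta> \<nu>)"
  by (simp add: fun_eq_iff mittag_leffler_def eval_fps_def mittag_leffler_fps_def)

text \<open>
  At \<open>t = 1\<close> the kernels reduce to \<open>1 / \<Gamma>\<close>, so the power series at \<open>z\<close> is the kernel series with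
  coefficients \<open>z\<^sup>n\<close>.
\<close>

lemma fps_conv_radius_mittag_leffler:
  assumes "\<beta> > 0" "\<nu> > 0"
  shows "fps_conv_radius (mittag_leffler_fps \<beta> \<nu>) = \<infinity>"
  unfolding fps_conv_radius_def
proof (rule conv_radius_inftyI'')
  fix z :: complex
  obtain r where "r > 0" "summable (\<lambda>n. norm (neg_binomial_coeff z 0 n) * r ^ n)"
    by (rule neg_binomial_coeff_summable)
  from summable_kernel_series[OF assms _ this, of 1]
  have "summable (\<lambda>n. z ^ n * complex_of_real (power_kernel (\<beta> * real n + \<nu>) 1))"
    by (simp add: neg_binomial_coeff_def)
  then show "summable (\<lambda>n. fps_nth (mittag_leffler_fps \<beta> \<nu>) n * z ^ n)"
    by (simp add: power_kernel_def mittag_leffler_fps_def)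
qed

text \<open>
  Differentiating the power series \<open>k\<close> times and dividing by \<open>k!\<close> leaves
  \<open>binom(n + k, k) z\<^sup>n / \<Gamma>(\<beta> (n + k) + \<nu>)\<close>; the prefactor \<open>t\<^bsup>k \<beta> + \<nu> - 1\<^esup>\<close> is just what turns
  the powers of \<open>z = \<mu> t\<^sup>\<beta>\<close> into the kernels that match these Gamma values. The case \<open>k = 0\<close> is
  the function under the integral on the right-hand side of the theorem.
\<close>

lemma deriv_mittag_leffler_conv_kernel_series:
  assumes \<beta>: "\<beta> > 0" and \<nu>: "\<nu> > 0" and s: "s \<ge> 0"
  shows "complex_of_real (s powr (real k * \<beta> + \<nu> - 1)) / fact k *
           (deriv ^^ k) (mittag_leffler \<beta> \<nu>) (\<mu> * complex_of_real (s powr \<beta>))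
         = kernel_series \<beta> (real k * \<beta> + \<nu>) (neg_binomial_coeff \<mu> k) s"
proof (cases "s = 0")
  case True
  then show ?thesis by (simp add: kernel_series_def)
next
  case False
  with s have s: "s > 0" by simp
  let ?E = "mittag_leffler_fps \<beta> \<nu>" and ?z = "\<mu> * complex_of_real (s powr \<beta>)"
  let ?c = "complex_of_real (s powr (real k * \<beta> + \<nu> - 1)) / fact k"
  have "fps_conv_radius (fps_nth_deriv k ?E) = \<infinity>"
  proof (induction k)
    case (Suc k)
    then show ?case
      using fps_conv_radius_deriv[of "fps_nth_deriv k ?E"] unfolding fps_nth_deriv_commute by simp
  qed (simp add: fps_conv_radius_mittag_leffler[OF \<beta> \<nu>])
  then have summ: "summable (\<lambda>n. fps_nth (fps_nth_deriv k ?E) n * ?z ^ n)"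
    by (intro summable_fps) simp
  have termwise: "?c * (fps_nth (fps_nth_deriv k ?E) n * ?z ^ n)
      = neg_binomial_coeff \<mu> k n * complex_of_real (power_kernel (\<beta> * real n + (real k * \<beta> + \<nu>)) s)" for n
  proof -
    have "of_nat ((n + k) choose k) = (fact (n + k) / (fact k * fact n) :: complex)"
      by (simp add: binomial_fact)
    moreover have "s powr (real k * \<beta> + \<nu> - 1) * (s powr \<beta>) ^ n
        = s powr (\<beta> * real n + (real k * \<beta> + \<nu>) - 1)"
      using s by (simp add: powr_realpow[symmetric] powr_powr powr_add[symmetric] algebra_simps)
    then have "complex_of_real (s powr (\<beta> * real n + (real k * \<beta> + \<nu>) - 1))
        = complex_of_real (s powr (real k * \<beta> + \<nu> - 1)) * complex_of_real (s powr \<beta>) ^ n"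
      by (metis of_real_mult of_real_power)
    moreover have "\<beta> * real (n + k) + \<nu> = \<beta> * real n + (real k * \<beta> + \<nu>)"
      by (simp add: algebra_simps)
    ultimately show ?thesis
      by (simp add: fps_nth_deriv_nth mittag_leffler_fps_def neg_binomial_coeff_def
          power_kernel_def power_mult_distrib add.assoc mult_ac)
  qed
  have "?c * (deriv ^^ k) (mittag_leffler \<beta> \<nu>) ?z
      = (\<Sum>n. ?c * (fps_nth (fps_nth_deriv k ?E) n * ?z ^ n))"
    unfolding mittag_leffler_conv_eval_fps eval_fps_def
      funpow_deriv_eval_fps[OF fps_conv_radius_mittag_leffler[OF \<beta> \<nu>]]
    by (rule suminf_mult[OF summ, symmetric])
  then show ?thesis
    by (simp only: termwise kernel_series_def)
qed

text \<open>
  The common generalization of the two relations: \<open>\<delta> = 0\<close> is included because \<open>J\<^sup>0\<close> is the identity.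
\<close>

lemma funpow_frac_integral_diff_mittag_leffler:
  fixes \<beta> \<delta> \<nu> :: real
  assumes \<beta>: "\<beta> > 0" and \<delta>: "\<delta> \<ge> 0" and \<nu>: "\<nu> > 0" and t: "t \<ge> 0"
  shows "((\<lambda>f s. frac_integral \<delta> f s - \<mu> * frac_integral (\<beta> + \<delta>) f s) ^^ k)
           (\<lambda>s. complex_of_real (s powr (real k * \<beta> + \<nu> - 1)) / fact k *
                (deriv ^^ k) (mittag_leffler \<beta> \<nu>) (\<mu> * complex_of_real (s powr \<beta>))) t
         = frac_integral (real k * (\<beta> + \<delta>))
             (\<lambda>s. complex_of_real (s powr (\<nu> - 1)) *
                  mittag_leffler \<beta> \<nu> (\<mu> * complex_of_real (s powr \<beta>))) t"
    (is "?lhs = frac_integral _ ?f t")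
proof -
  have "?lhs = kernel_series \<beta> (real k * \<beta> + \<nu> + real k * \<delta>) (neg_binomial_coeff \<mu> 0) t"
    using \<beta> \<delta> \<nu> t
    by (intro funpow_frac_integral_diff deriv_mittag_leffler_conv_kernel_series add_nonneg_pos) auto
  also have "\<dots> = kernel_series \<beta> (\<nu> + real k * (\<beta> + \<delta>)) (neg_binomial_coeff \<mu> 0) t"
    by (simp add: algebra_simps)
  also have "\<dots> = frac_integral (real k * (\<beta> + \<delta>)) ?f t"
  proof -
    obtain r where r: "r > 0" "summable (\<lambda>n. norm (neg_binomial_coeff \<mu> 0 n) * r ^ n)"
      by (rule neg_binomial_coeff_summable)
    have "?f s = kernel_series \<beta> \<nu> (neg_binomial_coeff \<mu> 0) s" if "s \<ge> 0" for s
      using deriv_mittag_leffler_conv_kernel_series[OF \<beta> \<nu> that, of 0 \<mu>] by simp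
    then show ?thesis
      using \<beta> \<delta> by (intro frac_integral_kernel_series[OF \<beta> \<nu> _ t r, symmetric]) auto
  qed
  finally show ?thesis .
qed

theorem lemma2p1:
  fixes \<beta> \<beta>\<^sub>1 \<beta>\<^sub>2 \<nu> :: real and \<mu> :: complex and k :: nat
  assumes "\<beta> > 0" and "0 < \<beta>\<^sub>1" and "\<beta>\<^sub>1 < \<beta>\<^sub>2" and "\<nu> > 0"
  shows
    "(\<forall>t>0.
        ((\<lambda>f s. f s - \<mu> * frac_integral \<beta> f s) ^^ k)
          (\<lambda>s. complex_of_real (s powr (real k * \<beta> + \<nu> - 1)) / fact k *
                (deriv ^^ k) (mittag_leffler \<beta> \<nu>) (\<mu> * complex_of_real (s powr \<beta>))) t
        = frac_integral (real k * \<beta>)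
            (\<lambda>s. complex_of_real (s powr (\<nu> - 1)) *
                  mittag_leffler \<beta> \<nu> (\<mu> * complex_of_real (s powr \<beta>))) t)
     \<and>
     (\<forall>t>0.
        ((\<lambda>f s. frac_integral (\<beta>\<^sub>2 - \<beta>\<^sub>1) f s - \<mu> * frac_integral \<beta>\<^sub>2 f s) ^^ k)
          (\<lambda>s. complex_of_real (s powr (real k * \<beta>\<^sub>1 + \<nu> - 1)) / fact k *
                (deriv ^^ k) (mittag_leffler \<beta>\<^sub>1 \<nu>) (\<mu> * complex_of_real (s powr \<beta>\<^sub>1))) t
        = frac_integral (real k * \<beta>\<^sub>2)
            (\<lambda>s. complex_of_real (s powr (\<nu> - 1)) *
                  mittag_leffler \<beta>\<^sub>1 \<nu> (\<mu> * complex_of_real (s powr \<beta>\<^sub>1))) t)"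
proof (intro conjI allI impI)
  fix t :: real
  assume "t > 0"
  then show "((\<lambda>f s. f s - \<mu> * frac_integral \<beta> f s) ^^ k)
          (\<lambda>s. complex_of_real (s powr (real k * \<beta> + \<nu> - 1)) / fact k *
                (deriv ^^ k) (mittag_leffler \<beta> \<nu>) (\<mu> * complex_of_real (s powr \<beta>))) t
        = frac_integral (real k * \<beta>)
            (\<lambda>s. complex_of_real (s powr (\<nu> - 1)) *
                  mittag_leffler \<beta> \<nu> (\<mu> * complex_of_real (s powr \<beta>))) t"
    using funpow_frac_integral_diff_mittag_leffler[of \<beta> 0 \<nu> t k \<mu>] assms
    by (simp add: frac_integral_def[of 0])
next
  fix t :: real
  assume "t > 0"
  then show "((\<lambda>f s. frac_integral (\<beta>\<^sub>2 - \<beta>\<^sub>1) f s - \<mu> * frac_integral \<beta>\<^sub>2 f s) ^^ k)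
          (\<lambda>s. complex_of_real (s powr (real k * \<beta>\<^sub>1 + \<nu> - 1)) / fact k *
                (deriv ^^ k) (mittag_leffler \<beta>\<^sub>1 \<nu>) (\<mu> * complex_of_real (s powr \<beta>\<^sub>1))) t
        = frac_integral (real k * \<beta>\<^sub>2)
            (\<lambda>s. complex_of_real (s powr (\<nu> - 1)) *
                  mittag_leffler \<beta>\<^sub>1 \<nu> (\<mu> * complex_of_real (s powr \<beta>\<^sub>1))) t"
    using funpow_frac_integral_diff_mittag_leffler[of \<beta>\<^sub>1 "\<beta>\<^sub>2 - \<beta>\<^sub>1" \<nu> t k \<mu>] assms
    by simp
qed

end
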